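(* There exist $3$-step real Carnot Lie algebras $\mathfrak f$ and $\mathfrak g$, both of vector space dimension $16$ and both of homogeneous dimension $28$, such that $w_{min}(\mathfrak f)=3$ and $w_{max}(\mathfrak g)=2$.
   Context: A ($s$-step) Carnot Lie algebra is a finite-dimensional real Lie algebra with a vector space decomposition $\mathfrak g=\mathfrak g_1\oplus\cdots\oplus\mathfrak g_s$, $\mathfrak g_s\ne0$, with $[\mathfrak g_1,\mathfrak g_i]=\mathfrak g_{i+1}$ for $1\le i<s$ and $[\mathfrak g_1,\mathfrak g_s]=0$. Its homogeneous dimension is $\sum_i i\dim(\mathfrak g_i)$. Elements of $\mathfrak g^*$ vanishing on all $\mathfrak g_i$, $i\ne w$, have weight $w$; weight is extended additively to wedge products, giving $\bigwedge^k\mathfrak g^*=\bigoplus_w\bigwedge^{k,w}$. The Chevalley–Eilenberg differential ($d\omega(X,Y)=-\omega([X,Y])$ on $1$-forms) preserves weights, so the Lie algebra cohomology with trivial real coefficients splits as $H^k(\mathfrak g)=\bigoplus_w H^{k,w}(\mathfrak g)$. $w_{min}(\mathfrak g)$ (resp. $w_{max}(\mathfrak g)$) is the least (resp. largest) $w$ such that $H^{2,w}(\mathfrak g)\ne0$. *)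

theory Defs
  imports "HOL-Analysis.Analysis" "HOL-Combinatorics.Permutations"
begin

locale lie_algebra =
  fixes br :: "'a::real_vector \<Rightarrow> 'a \<Rightarrow> 'a"
  assumes br_bilinear: "bilinear br"
    and br_alternating: "br x x = 0"
    and jacobi: "br x (br y z) + br y (br z x) + br z (br x y) = 0"

text \<open>Only the values \<open>V 1, \<dots>, V s\<close> of the family \<open>V\<close> are meaningful.  The bracket of two
  subspaces is the span of the brackets of their elements.\<close>

locale carnot_algebra = lie_algebra br
  for br :: "'a::real_vector \<Rightarrow> 'a \<Rightarrow> 'a" +
  fixes s :: nat and V :: "nat \<Rightarrow> 'a set"
  assumes finite_dim: "\<exists>B::'a set. finite B \<and> span B = UNIV"
    and step_pos: "1 \<le> s"
    and layer_subspace: "\<And>i. i \<in> {1..s} \<Longrightarrow> subspace (V i)"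
    and direct_sum: "\<And>x. \<exists>!v. v \<in> (\<Pi>\<^sub>E i\<in>{1..s}. V i) \<and> x = (\<Sum>i=1..s. v i)"
    and top_layer: "V s \<noteq> {0}"
    and generated: "\<And>i. 1 \<le> i \<Longrightarrow> i < s \<Longrightarrow> span {br x y |x y. x \<in> V 1 \<and> y \<in> V i} = V (Suc i)"
    and top_central: "\<And>x y. x \<in> V 1 \<Longrightarrow> y \<in> V s \<Longrightarrow> br x y = 0"

definition homogeneous_dim :: "nat \<Rightarrow> (nat \<Rightarrow> 'a::real_vector set) \<Rightarrow> nat" where
  "homogeneous_dim s V = (\<Sum>i=1..s. i * dim (V i))"

text \<open>A \<open>k\<close>-form is encoded as a real function on lists of vectors which is zero on lists of
  length different from \<open>k\<close>.  The wedge product is normalised by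
  \<open>(\<alpha>\<^sub>1 \<and> \<dots> \<and> \<alpha>\<^sub>k) (X\<^sub>1, \<dots>, X\<^sub>k) = det (\<alpha>\<^sub>i (X\<^sub>j))\<close>.\<close>

definition wedge :: "('a \<Rightarrow> real) list \<Rightarrow> 'a list \<Rightarrow> real" where
  "wedge \<alpha>s Xs = (if length Xs = length \<alpha>s
     then \<Sum>p | p permutes {..<length \<alpha>s}.
            of_int (sign p) * (\<Prod>i<length \<alpha>s. (\<alpha>s ! i) (Xs ! p i))
     else 0)"

definition covectors :: "nat \<Rightarrow> (nat \<Rightarrow> 'a::real_vector set) \<Rightarrow> nat \<Rightarrow> ('a \<Rightarrow> real) set" where
  "covectors s V w = {\<alpha>. linear \<alpha> \<and> (\<forall>i\<in>{1..s}. i \<noteq> w \<longrightarrow> (\<forall>x\<in>V i. \<alpha> x = 0))}"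

definition weighted_wedges :: "nat \<Rightarrow> (nat \<Rightarrow> 'a::real_vector set) \<Rightarrow> nat \<Rightarrow> nat \<Rightarrow> ('a list \<Rightarrow> real) set" where
  "weighted_wedges s V k w =
     {wedge \<alpha>s |\<alpha>s ws. length \<alpha>s = k \<and> length ws = k \<and> sum_list ws = w \<and>
        (\<forall>i<k. \<alpha>s ! i \<in> covectors s V (ws ! i))}"

text \<open>The linear span of the above, i.e. the weight \<open>w\<close> part of the \<open>k\<close>-th exterior power of the
  dual space.\<close>

definition forms :: "nat \<Rightarrow> (nat \<Rightarrow> 'a::real_vector set) \<Rightarrow> nat \<Rightarrow> nat \<Rightarrow> ('a list \<Rightarrow> real) set" where
  "forms s V k w =
     {\<lambda>Xs. \<Sum>\<eta>\<in>T. c \<eta> * \<eta> Xs |T c. finite T \<and> T \<subseteq> weighted_wedges s V k w}"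

text \<open>Trivial coefficients:
  \<open>d\<omega> (X\<^sub>0, \<dots>, X\<^sub>k) = \<Sum>\<^sub>i\<^sub><\<^sub>j (-1)\<^sup>i\<^sup>+\<^sup>j \<omega> ([X\<^sub>i, X\<^sub>j], X\<^sub>0, \<dots>, X\<^sub>k)\<close>, with \<open>X\<^sub>i\<close> and \<open>X\<^sub>j\<close>
  omitted from the tail.\<close>

definition ce_diff :: "('a \<Rightarrow> 'a \<Rightarrow> 'a) \<Rightarrow> ('a list \<Rightarrow> real) \<Rightarrow> 'a list \<Rightarrow> real" where
  "ce_diff br \<omega> Xs =
     (\<Sum>j<length Xs. \<Sum>i<j. (-1) ^ (i + j) * \<omega> (br (Xs ! i) (Xs ! j) # nths Xs (- {i, j})))"

definition cocycles ::
    "('a::real_vector \<Rightarrow> 'a \<Rightarrow> 'a) \<Rightarrow> nat \<Rightarrow> (nat \<Rightarrow> 'a set) \<Rightarrow> nat \<Rightarrow> nat \<Rightarrow> ('a list \<Rightarrow> real) set" where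
  "cocycles br s V k w = {\<omega> \<in> forms s V k w. \<forall>Xs. ce_diff br \<omega> Xs = 0}"

definition coboundaries ::
    "('a::real_vector \<Rightarrow> 'a \<Rightarrow> 'a) \<Rightarrow> nat \<Rightarrow> (nat \<Rightarrow> 'a set) \<Rightarrow> nat \<Rightarrow> nat \<Rightarrow> ('a list \<Rightarrow> real) set" where
  "coboundaries br s V k w =
     (if k = 0 then {\<lambda>_. 0} else ce_diff br ` forms s V (k - 1) w)"

text \<open>The quotient of cocycles by coboundaries, as a set of cosets; its zero element is
  \<open>coboundaries br s V k w\<close>.\<close>

definition cohomology ::
    "('a::real_vector \<Rightarrow> 'a \<Rightarrow> 'a) \<Rightarrow> nat \<Rightarrow> (nat \<Rightarrow> 'a set) \<Rightarrow> nat \<Rightarrow> nat \<Rightarrow> ('a list \<Rightarrow> real) set set" where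
  "cohomology br s V k w =
     (\<lambda>z. {\<lambda>Xs. z Xs + b Xs |b. b \<in> coboundaries br s V k w}) ` cocycles br s V k w"

definition cohomology_nonzero ::
    "('a::real_vector \<Rightarrow> 'a \<Rightarrow> 'a) \<Rightarrow> nat \<Rightarrow> (nat \<Rightarrow> 'a set) \<Rightarrow> nat \<Rightarrow> nat \<Rightarrow> bool" where
  "cohomology_nonzero br s V k w \<longleftrightarrow> cohomology br s V k w \<noteq> {coboundaries br s V k w}"

text \<open>The extremal weights are stated as relations, so that asserting one includes the
  nonvanishing of the second cohomology.\<close>

definition is_w_min ::
    "('a::real_vector \<Rightarrow> 'a \<Rightarrow> 'a) \<Rightarrow> nat \<Rightarrow> (nat \<Rightarrow> 'a set) \<Rightarrow> nat \<Rightarrow> bool" where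
  "is_w_min br s V w \<longleftrightarrow> cohomology_nonzero br s V 2 w \<and>
     (\<forall>w'. cohomology_nonzero br s V 2 w' \<longrightarrow> w \<le> w')"

definition is_w_max ::
    "('a::real_vector \<Rightarrow> 'a \<Rightarrow> 'a) \<Rightarrow> nat \<Rightarrow> (nat \<Rightarrow> 'a set) \<Rightarrow> nat \<Rightarrow> bool" where
  "is_w_max br s V w \<longleftrightarrow> cohomology_nonzero br s V 2 w \<and>
     (\<forall>w'. cohomology_nonzero br s V 2 w' \<longrightarrow> w' \<le> w)"

end

theory Submission
  imports Defs
begin

text \<open>
  Two-cocycles of weight \<open>w\<close> modulo exact ones are dual to the minimal relations of degree \<open>w\<close>
  among the generators, so an algebra with minimal weight three is one without quadratic
  relations, and one with maximal weight two is presented by quadratic relations alone.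

  The first algebra has layers of dimension 5, 10, 1.  Modulo its third layer it is the free two-step
  nilpotent algebra on five generators \<open>e\<^sub>0, \<dots>, e\<^sub>4\<close>, so there is no relation of degree two
  (\<open>near_free_cohomology_weight_le_2\<close>).  The third layer is spanned by \<open>[e\<^sub>0, [e\<^sub>0, e\<^sub>1]]\<close>, while
  the other triple brackets of the form \<open>[e\<^sub>i, [e\<^sub>j, e\<^sub>k]]\<close> with \<open>j < k\<close> are zero; the relation
  \<open>[e\<^sub>1, [e\<^sub>0, e\<^sub>1]] = 0\<close> gives a non-exact cocycle of weight three (\<open>near_free_cohomology_weight_3\<close>).

  The second algebra has layers of dimension 8, 4, 4.  Write \<open>x\<^sub>k\<close> for the coordinate covectors and
  \<open>p\<^sub>k = - d x\<^sub>k\<close>.  The covectors \<open>x\<^sub>8, \<dots>, x\<^sub>1\<^sub>1\<close> of weight two satisfy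
  \<open>p\<^sub>8 = x\<^sub>3 \<and> x\<^sub>1 + x\<^sub>0 \<and> x\<^sub>5\<close>, \<open>p\<^sub>9 = x\<^sub>0 \<and> x\<^sub>1 + x\<^sub>4 \<and> x\<^sub>5\<close>, \<open>p\<^sub>1\<^sub>0 = x\<^sub>0 \<and> x\<^sub>4 + x\<^sub>2 \<and> x\<^sub>1\<close>,
  \<open>p\<^sub>1\<^sub>1 = x\<^sub>0 \<and> x\<^sub>1 + x\<^sub>2 \<and> x\<^sub>3\<close>.  A form \<open>\<Sum> \<theta>\<^sub>k \<and> x\<^sub>k\<close> of weight three is closed iff
  \<open>\<Sum> \<theta>\<^sub>k \<and> p\<^sub>k = 0\<close>, and the solutions of this linear system are spanned by the four dependencies
  \<open>x\<^sub>1 \<and> p\<^sub>8 + x\<^sub>5 \<and> p\<^sub>9 = 0\<close>, \<open>x\<^sub>4 \<and> p\<^sub>9 + x\<^sub>1 \<and> p\<^sub>1\<^sub>0 = 0\<close>, \<open>x\<^sub>0 \<and> p\<^sub>1\<^sub>0 + x\<^sub>2 \<and> p\<^sub>1\<^sub>1 = 0\<close>,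
  \<open>x\<^sub>3 \<and> p\<^sub>1\<^sub>1 + x\<^sub>0 \<and> p\<^sub>8 = 0\<close>.  The third layer is defined so that the corresponding closed forms are
  \<open>p\<^sub>1\<^sub>2, \<dots>, p\<^sub>1\<^sub>5\<close>, which kills the cohomology of weight three.  In weight four
  no nonzero form is closed, as a direct elimination shows.  In weights five and six every
  cocycle vanishes because it pairs the derived algebra trivially with the center
  (\<open>cocycle_2_central\<close>).  Together this is \<open>quad_cohomology_weight_ge_3\<close>.  The generators
  \<open>e\<^sub>6\<close> and \<open>e\<^sub>7\<close> are central, and \<open>x\<^sub>6 \<and> x\<^sub>7\<close> is a non-exact cocycle of weight two.
\<close>

section \<open>Forms of degree one and two\<close>

lemma wedge_single: "wedge [\<alpha>] = (\<lambda>Xs. if length Xs = 1 then \<alpha> (hd Xs) else 0)"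
proof
  fix Xs :: "'a list"
  have perms: "{p. p permutes {..<Suc 0}} = {id}"
    by (simp add: lessThan_Suc permutes_sing)
  show "wedge [\<alpha>] Xs = (if length Xs = 1 then \<alpha> (hd Xs) else 0)"
    by (cases Xs) (simp_all add: wedge_def perms)
qed

lemma wedge_pair:
  "wedge [\<alpha>, \<beta>] Xs = (if length Xs = 2 then \<alpha> (Xs ! 0) * \<beta> (Xs ! 1) - \<alpha> (Xs ! 1) * \<beta> (Xs ! 0) else 0)"
proof -
  have set2: "{..<Suc (Suc 0)} = {0, Suc 0}" by auto
  have perms: "{p. p permutes {0, Suc 0}} = {id, Transposition.transpose 0 (Suc 0)}"
    by (auto simp: permutes_doubleton_iff)
  have "Transposition.transpose 0 (Suc 0) 0 \<noteq> id 0" by simp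
  then have ne: "id \<noteq> Transposition.transpose 0 (Suc 0)" by metis
  show ?thesis
    using ne by (simp add: wedge_def set2 perms sign_swap_id)
qed

lemma linear_scaled: "linear f \<Longrightarrow> linear (\<lambda>x. c * f x)" for f :: "'a::real_vector \<Rightarrow> real"
  using linear_compose_scale_right[of f c] by simp

lemma forms_1_eq:
  "forms s V 1 w = (\<lambda>\<alpha>. wedge [\<alpha>]) ` covectors s V w" (is "_ = ?R")
proof (intro equalityI subsetI)
  fix \<omega> assume "\<omega> \<in> forms s V 1 w"
  then obtain T c where fin: "finite T" and T: "T \<subseteq> weighted_wedges s V 1 w"
    and \<omega>: "\<omega> = (\<lambda>Xs. \<Sum>\<eta>\<in>T. c \<eta> * \<eta> Xs)" by (auto simp: forms_def)
  have el: "\<exists>\<alpha>\<in>covectors s V w. \<eta> = wedge [\<alpha>]" if "\<eta> \<in> T" for \<eta>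
  proof -
    from that T have "\<eta> \<in> weighted_wedges s V 1 w" by blast
    then obtain \<alpha>s ws where *: "\<eta> = wedge \<alpha>s" "length \<alpha>s = 1" "length ws = 1" "sum_list ws = w"
      "\<alpha>s ! 0 \<in> covectors s V (ws ! 0)" unfolding weighted_wedges_def by auto
    then obtain \<alpha> u where "\<alpha>s = [\<alpha>]" "ws = [u]"
      by (metis One_nat_def length_0_conv length_Suc_conv)
    with * show ?thesis by auto
  qed
  have len: "\<omega> Xs = 0" if "length Xs \<noteq> 1" for Xs
    unfolding \<omega>
  proof (intro sum.neutral ballI)
    fix \<eta> assume "\<eta> \<in> T"
    from el[OF this] that show "c \<eta> * \<eta> Xs = 0" by (auto simp: wedge_single)
  qed
  have cov: "(\<lambda>x. \<eta> [x]) \<in> covectors s V w" if "\<eta> \<in> T" for \<eta>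
    using el[OF that] by (auto simp: wedge_single)
  have "(\<lambda>x. \<omega> [x]) \<in> covectors s V w"
  proof -
    have "linear (\<lambda>x. \<Sum>\<eta>\<in>T. c \<eta> * \<eta> [x])"
      using cov by (intro linear_compose_sum ballI linear_scaled) (simp add: covectors_def)
    moreover have "\<omega> [x] = 0" if "i \<in> {1..s}" "i \<noteq> w" "x \<in> V i" for i x
      unfolding \<omega>
    proof (intro sum.neutral ballI)
      fix \<eta> assume "\<eta> \<in> T"
      from cov[OF this] that show "c \<eta> * \<eta> [x] = 0" by (auto simp: covectors_def)
    qed
    ultimately show ?thesis by (simp add: \<omega> covectors_def)
  qed
  moreover have "\<omega> = wedge [\<lambda>x. \<omega> [x]]"
    unfolding wedge_single
  proof
    fix Xs show "\<omega> Xs = (if length Xs = 1 then \<omega> [hd Xs] else 0)"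
      using len[of Xs] by (cases Xs) auto
  qed
  ultimately show "\<omega> \<in> ?R" by (intro image_eqI)
next
  fix \<omega> assume "\<omega> \<in> ?R"
  then obtain \<alpha> where \<alpha>: "\<alpha> \<in> covectors s V w" and \<omega>: "\<omega> = wedge [\<alpha>]"
    by blast
  have "wedge [\<alpha>] \<in> weighted_wedges s V 1 w"
    unfolding weighted_wedges_def
  proof (intro CollectI exI conjI)
    show "\<forall>i<1. [\<alpha>] ! i \<in> covectors s V ([w] ! i)"
      using \<alpha> by simp
  qed simp_all
  then show "\<omega> \<in> forms s V 1 w"
    unfolding forms_def \<omega> by (auto intro!: exI[of _ "{wedge [\<alpha>]}"] exI[of _ "\<lambda>_. 1"])
qed

lemma wedge_pair_in_forms:
  assumes "\<alpha> \<in> covectors s V u" "\<beta> \<in> covectors s V v"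
  shows "wedge [\<alpha>, \<beta>] \<in> forms s V 2 (u + v)"
proof -
  have "wedge [\<alpha>, \<beta>] \<in> weighted_wedges s V 2 (u + v)"
    unfolding weighted_wedges_def
  proof (intro CollectI exI conjI)
    show "\<forall>i<2. [\<alpha>, \<beta>] ! i \<in> covectors s V ([u, v] ! i)"
      using assms by (auto dest: less_2_cases)
  qed simp_all
  then show ?thesis
    unfolding forms_def by (auto intro!: exI[of _ "{wedge [\<alpha>, \<beta>]}"] exI[of _ "\<lambda>_. 1"])
qed

lemma forms_2D:
  assumes "\<omega> \<in> forms s V 2 w"
  shows forms_2_length: "length Xs \<noteq> 2 \<Longrightarrow> \<omega> Xs = 0"
    and forms_2_bilinear: "bilinear (\<lambda>x y. \<omega> [x, y])"
    and forms_2_alternating: "\<omega> [x, x] = 0"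
    and forms_2_weight: "i \<in> {1..s} \<Longrightarrow> j \<in> {1..s} \<Longrightarrow> x \<in> V i \<Longrightarrow> y \<in> V j \<Longrightarrow> i + j \<noteq> w \<Longrightarrow> \<omega> [x, y] = 0"
proof -
  obtain T c where fin: "finite T" and T: "T \<subseteq> weighted_wedges s V 2 w"
    and \<omega>: "\<omega> = (\<lambda>Xs. \<Sum>\<eta>\<in>T. c \<eta> * \<eta> Xs)" using assms by (auto simp: forms_def)
  have el: "\<exists>\<alpha> \<beta> u v. \<alpha> \<in> covectors s V u \<and> \<beta> \<in> covectors s V v \<and> u + v = w \<and> \<eta> = wedge [\<alpha>, \<beta>]"
    if "\<eta> \<in> T" for \<eta>
  proof -
    from that T have "\<eta> \<in> weighted_wedges s V 2 w" by blast
    then obtain \<alpha>s ws where *: "\<eta> = wedge \<alpha>s" "length \<alpha>s = 2" "length ws = 2" "sum_list ws = w"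
      "\<forall>i<2. \<alpha>s ! i \<in> covectors s V (ws ! i)" unfolding weighted_wedges_def by auto
    from *(2) obtain \<alpha> \<beta> where "\<alpha>s = [\<alpha>, \<beta>]"
      by (auto simp: numeral_2_eq_2 length_Suc_conv)
    moreover from *(3) obtain u v where "ws = [u, v]"
      by (auto simp: numeral_2_eq_2 length_Suc_conv)
    ultimately show ?thesis
      using *(1,4) spec[OF *(5), of 0] spec[OF *(5), of 1] by auto
  qed
  show "\<omega> Xs = 0" if "length Xs \<noteq> 2"
    unfolding \<omega>
  proof (intro sum.neutral ballI)
    fix \<eta> assume "\<eta> \<in> T"
    from el[OF this] that show "c \<eta> * \<eta> Xs = 0" by (auto simp: wedge_pair)
  qed
  show "\<omega> [x, x] = 0"
    unfolding \<omega>
  proof (intro sum.neutral ballI)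
    fix \<eta> assume "\<eta> \<in> T"
    from el[OF this] show "c \<eta> * \<eta> [x, x] = 0" by (auto simp: wedge_pair)
  qed
  show "\<omega> [x, y] = 0" if "i \<in> {1..s}" "j \<in> {1..s}" "x \<in> V i" "y \<in> V j" "i + j \<noteq> w"
    unfolding \<omega>
  proof (intro sum.neutral ballI)
    fix \<eta> assume "\<eta> \<in> T"
    then obtain \<alpha> \<beta> u v where ab: "\<alpha> \<in> covectors s V u" "\<beta> \<in> covectors s V v" "u + v = w" "\<eta> = wedge [\<alpha>, \<beta>]"
      using el by blast
    have "i \<noteq> u \<or> j \<noteq> v" "j \<noteq> u \<or> i \<noteq> v" using ab(3) that(5) by auto
    moreover have "i \<noteq> u \<Longrightarrow> \<alpha> x = 0" "j \<noteq> v \<Longrightarrow> \<beta> y = 0" "j \<noteq> u \<Longrightarrow> \<alpha> y = 0" "i \<noteq> v \<Longrightarrow> \<beta> x = 0"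
      using ab(1,2) that(1-4) unfolding covectors_def by blast+
    ultimately have "\<alpha> x * \<beta> y = 0" "\<alpha> y * \<beta> x = 0" by auto
    then show "c \<eta> * \<eta> [x, y] = 0" by (auto simp: ab(4) wedge_pair)
  qed
  have lin: "linear (\<lambda>x. \<eta> [x, y]) \<and> linear (\<lambda>x. \<eta> [y, x])" if "\<eta> \<in> T" for \<eta> y
  proof -
    from el[OF that] obtain \<alpha> \<beta> u v where ab: "\<alpha> \<in> covectors s V u" "\<beta> \<in> covectors s V v" "\<eta> = wedge [\<alpha>, \<beta>]"
      by blast
    then have "linear \<alpha>" "linear \<beta>" by (auto simp: covectors_def)
    then show ?thesis
      by (simp add: ab wedge_pair linear_iff algebra_simps)
  qed
  show "bilinear (\<lambda>x y. \<omega> [x, y])"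
    unfolding bilinear_def \<omega> using lin
    by (intro conjI allI linear_compose_sum ballI linear_scaled) simp_all
qed

section \<open>The second cohomology\<close>

lemma length_nths_delete_two:
  assumes "i < j" "j < length xs"
  shows "length (nths xs (- {i, j})) = length xs - 2"
proof -
  have "{k. k < length xs \<and> k \<in> - {i, j}} = {..<length xs} - {i, j}" by auto
  moreover have "card ({..<length xs} - {i, j}) = length xs - 2"
    using assms by (subst card_Diff_subset) auto
  ultimately show ?thesis by (simp add: length_nths)
qed

lemma ce_diff_length:
  assumes "\<And>Xs. length Xs \<noteq> k \<Longrightarrow> \<omega> Xs = 0" "length Xs \<noteq> Suc k" "k \<noteq> 0"
  shows "ce_diff br \<omega> Xs = 0"
  unfolding ce_diff_def
proof (intro sum.neutral ballI)
  fix i j assume ij: "j \<in> {..<length Xs}" "i \<in> {..<j}"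
  then have "length (br (Xs ! i) (Xs ! j) # nths Xs (- {i, j})) \<noteq> k"
    using assms(2,3) length_nths_delete_two[of i j Xs] by auto
  then show "(- 1) ^ (i + j) * \<omega> (br (Xs ! i) (Xs ! j) # nths Xs (- {i, j})) = 0"
    using assms(1) by auto
qed

lemma ce_diff_1: "ce_diff br \<omega> [x, y] = - \<omega> [br x y]"
  by (simp add: ce_diff_def lessThan_Suc nths_Cons)

lemma ce_diff_2:
  "ce_diff br \<omega> [x, y, z] = - \<omega> [br x y, z] + \<omega> [br x z, y] - \<omega> [br y z, x]"
  by (simp add: ce_diff_def lessThan_Suc nths_Cons)

lemma cocycles_2_iff:
  "\<omega> \<in> cocycles br s V 2 w \<longleftrightarrow> \<omega> \<in> forms s V 2 w \<and>
     (\<forall>x y z. \<omega> [br x y, z] - \<omega> [br x z, y] + \<omega> [br y z, x] = 0)"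
proof -
  have "(\<forall>Xs. ce_diff br \<omega> Xs = 0) \<longleftrightarrow> (\<forall>x y z. ce_diff br \<omega> [x, y, z] = 0)"
    if "\<omega> \<in> forms s V 2 w"
  proof (intro iffI allI)
    fix Xs assume *: "\<forall>x y z. ce_diff br \<omega> [x, y, z] = 0"
    show "ce_diff br \<omega> Xs = 0"
    proof (cases "length Xs = 3")
      case True
      then obtain x y z where "Xs = [x, y, z]"
        by (metis length_0_conv length_Suc_conv numeral_3_eq_3)
      with * show ?thesis by simp
    next
      case False
      then show ?thesis
        by (intro ce_diff_length[of 2]) (auto simp: forms_2_length[OF that])
    qed
  qed simp
  moreover have "ce_diff br \<omega> [x, y, z] = 0 \<longleftrightarrow>
      \<omega> [br x y, z] - \<omega> [br x z, y] + \<omega> [br y z, x] = 0" for x y z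
    by (auto simp: ce_diff_2)
  ultimately show ?thesis by (auto simp: cocycles_def)
qed

lemma ce_diff_wedge_single:
  "ce_diff br (wedge [\<alpha>]) Xs = (if length Xs = 2 then - \<alpha> (br (Xs ! 0) (Xs ! 1)) else 0)"
proof (cases "length Xs = 2")
  case True
  then obtain x y where "Xs = [x, y]"
    by (metis length_0_conv length_Suc_conv numeral_2_eq_2)
  then show ?thesis by (simp add: ce_diff_1 wedge_single)
next
  case False
  then show ?thesis by (simp add: ce_diff_length[of 1] wedge_single)
qed

lemma coboundaries_2_eq:
  "coboundaries br s V 2 w = (\<lambda>\<alpha>. ce_diff br (wedge [\<alpha>])) ` covectors s V w"
  using forms_1_eq[of s V w] by (simp add: coboundaries_def image_image)

lemma image_eq_singleton_iff: "a \<in> A \<Longrightarrow> f ` A = {b} \<longleftrightarrow> (\<forall>z\<in>A. f z = b)"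
  by (auto simp: set_eq_iff image_iff)

text \<open>A two-cocycle is exact iff it is minus the composition of a covector of the same weight with
  the bracket; the cosets in the definition disappear because the coboundaries form a subspace.\<close>

lemma cohomology_nonzero_2_iff:
  "cohomology_nonzero br s V 2 w \<longleftrightarrow>
     (\<exists>\<omega>\<in>cocycles br s V 2 w. \<forall>\<alpha>\<in>covectors s V w. \<exists>x y. \<omega> [x, y] \<noteq> - \<alpha> (br x y))"
proof -
  let ?B = "coboundaries br s V 2 w" and ?Z = "cocycles br s V 2 w"
  have zero_cov: "(\<lambda>_. 0) \<in> covectors s V w"
    by (simp add: covectors_def linear_zero)
  have zero_coc: "(\<lambda>_. 0) \<in> ?Z"
    by (auto simp: cocycles_def forms_def ce_diff_def intro!: exI[of _ "{}"])
  have zero_cob: "(\<lambda>_. 0) \<in> ?B"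
    unfolding coboundaries_2_eq
    by (rule image_eqI[OF _ zero_cov]) (simp add: fun_eq_iff ce_diff_wedge_single)
  have add_cob: "(\<lambda>Xs. a Xs + b Xs) \<in> ?B" if ab: "a \<in> ?B" "b \<in> ?B" for a b
  proof -
    obtain \<alpha> \<beta> where *: "\<alpha> \<in> covectors s V w" "a = ce_diff br (wedge [\<alpha>])"
        "\<beta> \<in> covectors s V w" "b = ce_diff br (wedge [\<beta>])"
      using ab by (auto simp: coboundaries_2_eq)
    then have "(\<lambda>x. \<alpha> x + \<beta> x) \<in> covectors s V w"
      by (simp add: covectors_def linear_compose_add)
    moreover have "(\<lambda>Xs. a Xs + b Xs) = ce_diff br (wedge [\<lambda>x. \<alpha> x + \<beta> x])"
      by (simp add: fun_eq_iff * ce_diff_wedge_single)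
    ultimately show ?thesis unfolding coboundaries_2_eq by (intro image_eqI)
  qed
  have minus_cob: "(\<lambda>Xs. - a Xs) \<in> ?B" if a: "a \<in> ?B" for a
  proof -
    obtain \<alpha> where *: "\<alpha> \<in> covectors s V w" "a = ce_diff br (wedge [\<alpha>])"
      using a by (auto simp: coboundaries_2_eq)
    then have "(\<lambda>x. - \<alpha> x) \<in> covectors s V w"
      by (simp add: covectors_def linear_compose_neg)
    moreover have "(\<lambda>Xs. - a Xs) = ce_diff br (wedge [\<lambda>x. - \<alpha> x])"
      by (simp add: fun_eq_iff * ce_diff_wedge_single)
    ultimately show ?thesis unfolding coboundaries_2_eq by (intro image_eqI)
  qed
  have coset: "{\<lambda>Xs. z Xs + b Xs |b. b \<in> ?B} = ?B \<longleftrightarrow> z \<in> ?B" for z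
  proof
    assume eq: "{\<lambda>Xs. z Xs + b Xs |b. b \<in> ?B} = ?B"
    have "(\<lambda>Xs. z Xs + (\<lambda>_. 0) Xs) \<in> {\<lambda>Xs. z Xs + b Xs |b. b \<in> ?B}"
      by (rule CollectI, rule exI, rule conjI[OF refl zero_cob])
    then show "z \<in> ?B" unfolding eq by simp
  next
    assume z: "z \<in> ?B"
    show "{\<lambda>Xs. z Xs + b Xs |b. b \<in> ?B} = ?B"
    proof (intro equalityI subsetI)
      fix x assume "x \<in> {\<lambda>Xs. z Xs + b Xs |b. b \<in> ?B}"
      then show "x \<in> ?B" using add_cob[OF z] by auto
    next
      fix x assume x: "x \<in> ?B"
      have "x = (\<lambda>Xs. z Xs + (x Xs + - z Xs))" by simp
      with add_cob[OF x minus_cob[OF z]]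
      show "x \<in> {\<lambda>Xs. z Xs + b Xs |b. b \<in> ?B}"
        by (intro CollectI exI[of _ "\<lambda>Xs. x Xs + - z Xs"] conjI)
    qed
  qed
  have "cohomology_nonzero br s V 2 w \<longleftrightarrow> (\<exists>z\<in>?Z. z \<notin> ?B)"
  proof -
    have "C ` ?Z = {?B} \<longleftrightarrow> (\<forall>z\<in>?Z. C z = ?B)" for C
      by (rule image_eq_singleton_iff[OF zero_coc])
    then show ?thesis
      unfolding cohomology_nonzero_def cohomology_def by (simp add: coset)
  qed
  moreover have "z \<in> ?B \<longleftrightarrow> (\<exists>\<alpha>\<in>covectors s V w. \<forall>x y. z [x, y] = - \<alpha> (br x y))" if "z \<in> ?Z" for z
  proof
    assume "\<exists>\<alpha>\<in>covectors s V w. \<forall>x y. z [x, y] = - \<alpha> (br x y)"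
    then obtain \<alpha> where \<alpha>: "\<alpha> \<in> covectors s V w" "\<And>x y. z [x, y] = - \<alpha> (br x y)" by blast
    have "z Xs = ce_diff br (wedge [\<alpha>]) Xs" for Xs
    proof (cases "length Xs = 2")
      case True
      then obtain x y where "Xs = [x, y]"
        by (metis length_0_conv length_Suc_conv numeral_2_eq_2)
      then show ?thesis by (simp add: \<alpha>(2) ce_diff_wedge_single)
    next
      case False
      with that have "z \<in> forms s V 2 w" by (simp add: cocycles_def)
      with False show ?thesis by (simp add: forms_2_length ce_diff_wedge_single)
    qed
    then have "z = ce_diff br (wedge [\<alpha>])" by (rule ext)
    with \<alpha>(1) show "z \<in> ?B" unfolding coboundaries_2_eq by (intro image_eqI)
  next
    assume "z \<in> ?B"
    then obtain \<alpha> where "\<alpha> \<in> covectors s V w" "z = ce_diff br (wedge [\<alpha>])"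
      by (auto simp: coboundaries_2_eq)
    then show "\<exists>\<alpha>\<in>covectors s V w. \<forall>x y. z [x, y] = - \<alpha> (br x y)"
      by (intro bexI[of _ \<alpha>]) (simp_all add: ce_diff_wedge_single)
  qed
  ultimately show ?thesis by blast
qed

section \<open>Coordinates on 16-dimensional space\<close>

text \<open>The standard basis and its coordinates are indexed by the natural numbers below 16, embedded in
  the index type by \<open>of_nat\<close>.\<close>

definition bas :: "nat \<Rightarrow> real^16" where "bas k = axis (of_nat k) 1"

definition crd :: "nat \<Rightarrow> real^16 \<Rightarrow> real" where "crd k x = x $ of_nat k"

lemma of_nat_16_eq_iff:
  assumes "i < 16" "j < 16"
  shows "(of_nat i :: 16) = of_nat j \<longleftrightarrow> i = j"
proof -
  have less: "b = a" if "a \<le> b" "b < 16" "(of_nat a :: 16) = of_nat b" for a b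
  proof -
    have "(of_nat (b - a) :: 16) = 0" using that by (simp add: of_nat_diff)
    then have "16 dvd b - a" by (simp add: of_nat_eq_0_iff_char_dvd)
    then show ?thesis using that by (auto dest: dvd_imp_le)
  qed
  from less[of i j] less[of j i] assms show ?thesis by (cases "i \<le> j") auto
qed

lemma UNIV_16: "(UNIV :: 16 set) = of_nat ` {..<16}"
proof -
  have "inj_on (of_nat :: nat \<Rightarrow> 16) {..<16}"
    by (auto simp: inj_on_def of_nat_16_eq_iff)
  then have "card (of_nat ` {..<16} :: 16 set) = CARD(16)"
    by (simp add: card_image)
  then show ?thesis by (metis card_subset_eq finite_class.finite_UNIV subset_UNIV)
qed

lemma crd_bas: "i < 16 \<Longrightarrow> k < 16 \<Longrightarrow> crd k (bas i) = (if k = i then 1 else 0)"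
  by (simp add: crd_def bas_def axis_def of_nat_16_eq_iff)

lemma linear_crd: "linear (crd k)"
  by (simp add: linear_iff crd_def)

lemma crd_eqI:
  assumes "\<And>k. k < 16 \<Longrightarrow> crd k x = crd k y"
  shows "x = y"
proof -
  have "x $ i = y $ i" for i
  proof -
    have "i \<in> of_nat ` {..<16}" using UNIV_16 by blast
    then show ?thesis using assms by (auto simp: crd_def)
  qed
  then show ?thesis by (simp add: vec_eq_iff)
qed

lemma Basis_16: "(Basis :: (real^16) set) = bas ` {..<16}"
  by (auto simp: Basis_vec_def bas_def UNIV_16)

lemma inj_on_bas: "inj_on bas {..<16}"
  using crd_bas by (metis inj_onI lessThan_iff zero_neq_one)

lemma crd_simps [simp]:
  "crd k 0 = 0" "crd k (x + y) = crd k x + crd k y" "crd k (x - y) = crd k x - crd k y"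
  "crd k (- x) = - crd k x" "crd k (c *\<^sub>R x) = c * crd k x"
  "crd k (sum f A) = (\<Sum>a\<in>A. crd k (f a))"
  by (simp_all add: crd_def)

lemma sum_crd_bas: "(\<Sum>k<16. crd k x *\<^sub>R bas k) = x"
proof (rule crd_eqI)
  fix k :: nat assume k: "k < 16"
  have "(\<Sum>i<16. crd i x * crd k (bas i)) = (\<Sum>i<16. if k = i then crd i x else 0)"
    using k by (intro sum.cong) (auto simp: crd_bas)
  with k show "crd k (\<Sum>k<16. crd k x *\<^sub>R bas k) = crd k x" by simp
qed

lemma all_less_16:
  "(\<forall>k<16. Q k) \<longleftrightarrow> Q 15 \<and> Q 14 \<and> Q 13 \<and> Q 12 \<and> Q 11 \<and> Q 10 \<and> Q 9 \<and> Q 8 \<and> Q 7 \<and> Q 6 \<and> Q 5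
     \<and> Q 4 \<and> Q 3 \<and> Q 2 \<and> Q 1 \<and> Q (0::nat)"
  by (simp add: eval_nat_numeral All_less_Suc)

lemma alternating_skew:
  fixes f :: "'a::real_vector \<Rightarrow> 'a \<Rightarrow> real"
  assumes f: "bilinear f" "\<And>x. f x x = 0"
  shows "f y x = - f x y"
proof -
  have "f (x + y) (x + y) = f x x + f x y + (f y x + f y y)"
    by (simp only: bilinear_ladd[OF f(1)] bilinear_radd[OF f(1)] add_ac)
  then show ?thesis using f(2)[of "x + y"] f(2)[of x] f(2)[of y] by linarith
qed

lemma alternating_eqI:
  assumes f: "bilinear f" "\<And>x. f x x = 0" and g: "bilinear g" "\<And>x. g x x = 0"
    and eq: "\<And>i j. i < 16 \<Longrightarrow> j < i \<Longrightarrow> f (bas i) (bas j) = g (bas i) (bas j)"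
  shows "f x y = (g x y :: real)"
proof -
  have "f (bas i) (bas j) = g (bas i) (bas j)" if "i < 16" "j < 16" for i j
    using that eq[of i j] eq[of j i] f(2)[of "bas i"] g(2)[of "bas i"]
      alternating_skew[OF f, of "bas i" "bas j"] alternating_skew[OF g, of "bas i" "bas j"]
    by (cases i j rule: linorder_cases) auto
  then have "f = g"
    by (intro bilinear_eq_stdbasis[OF f(1) g(1)]) (auto simp: Basis_16)
  then show ?thesis by simp
qed

section \<open>Graded subspaces spanned by basis vectors\<close>

text \<open>The span of the basis vectors \<open>bas k\<close> with \<open>wt k = i\<close>, where \<open>wt\<close> assigns a weight to each
  basis vector.\<close>

definition layer :: "(nat \<Rightarrow> nat) \<Rightarrow> nat \<Rightarrow> (real^16) set" where
  "layer wt i = {x. \<forall>k<16. wt k \<noteq> i \<longrightarrow> crd k x = 0}"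

lemma subspace_layer: "subspace (layer wt i)"
  by (auto simp: subspace_def layer_def)

lemma bas_in_layer: "k < 16 \<Longrightarrow> wt k = i \<Longrightarrow> bas k \<in> layer wt i"
  by (auto simp: layer_def crd_bas)

lemma layer_eq_span: "layer wt i = span (bas ` {k. k < 16 \<and> wt k = i})"
proof
  show "span (bas ` {k. k < 16 \<and> wt k = i}) \<subseteq> layer wt i"
    by (intro span_minimal subspace_layer) (auto simp: bas_in_layer)
  show "layer wt i \<subseteq> span (bas ` {k. k < 16 \<and> wt k = i})"
  proof
    fix x assume x: "x \<in> layer wt i"
    have "crd k x *\<^sub>R bas k \<in> span (bas ` {k. k < 16 \<and> wt k = i})" if "k < 16" for k
    proof (cases "wt k = i")
      case True
      with that show ?thesis by (intro span_scale span_base) auto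
    next
      case False
      with x that show ?thesis by (simp add: layer_def span_zero)
    qed
    then have "(\<Sum>k<16. crd k x *\<^sub>R bas k) \<in> span (bas ` {k. k < 16 \<and> wt k = i})"
      by (intro span_sum) simp
    then show "x \<in> span (bas ` {k. k < 16 \<and> wt k = i})" by (simp only: sum_crd_bas)
  qed
qed

lemma dim_layer: "dim (layer wt i) = card {k. k < 16 \<and> wt k = i}"
proof -
  let ?K = "{k. k < 16 \<and> wt k = i}"
  have sub: "?K \<subseteq> {..<16}" by auto
  have "independent (bas ` ?K)"
    by (rule independent_mono[OF independent_Basis]) (auto simp: Basis_16)
  then have "dim (layer wt i) = card (bas ` ?K)"
    unfolding layer_eq_span dim_span by (rule dim_eq_card_independent)
  also have "\<dots> = card ?K"
    by (intro card_image inj_on_subset[OF inj_on_bas sub])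
  finally show ?thesis .
qed

lemma layers_direct_sum:
  assumes wt: "\<And>k. k < 16 \<Longrightarrow> wt k \<in> {1..s}"
  shows "\<exists>!v. v \<in> (\<Pi>\<^sub>E i\<in>{1..s}. layer wt i) \<and> x = (\<Sum>i=1..s. v i)"
proof -
  define p where "p i = (\<Sum>k | k < 16 \<and> wt k = i. crd k x *\<^sub>R bas k)" for i
  have p: "p i \<in> layer wt i" for i
    unfolding p_def layer_eq_span by (intro span_sum span_scale span_base) auto
  have coord: "crd k (\<Sum>i=1..s. v i) = crd k (v (wt k))"
    if v: "v \<in> (\<Pi>\<^sub>E i\<in>{1..s}. layer wt i)" and k: "k < 16" for v k
  proof -
    have "crd k (v i) = (if i = wt k then crd k (v i) else 0)" if "i \<in> {1..s}" for i
      using v that k by (auto simp: layer_def PiE_iff)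
    then have "(\<Sum>i=1..s. crd k (v i)) = (\<Sum>i=1..s. if i = wt k then crd k (v i) else 0)"
      by (intro sum.cong refl)
    with wt[OF k] show ?thesis by simp
  qed
  show ?thesis
  proof (rule ex1I[of _ "restrict p {1..s}"], intro conjI)
    show in_PiE: "restrict p {1..s} \<in> (\<Pi>\<^sub>E i\<in>{1..s}. layer wt i)"
      using p by auto
    show "x = (\<Sum>i=1..s. restrict p {1..s} i)"
    proof (rule crd_eqI)
      fix k :: nat assume k: "k < 16"
      have "crd k (p (wt k)) = (\<Sum>i | i < 16 \<and> wt i = wt k. if k = i then crd i x else 0)"
        unfolding p_def crd_simps using k by (intro sum.cong) (auto simp: crd_bas)
      also have "\<dots> = crd k x" using k by (simp add: sum.delta)
      finally show "crd k x = crd k (\<Sum>i=1..s. restrict p {1..s} i)"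
        using coord[OF in_PiE k] wt[OF k] by simp
    qed
  next
    fix v assume v: "v \<in> (\<Pi>\<^sub>E i\<in>{1..s}. layer wt i) \<and> x = (\<Sum>i=1..s. v i)"
    show "v = restrict p {1..s}"
    proof
      fix i show "v i = restrict p {1..s} i"
      proof (cases "i \<in> {1..s}")
        case True
        have "v i = p i"
        proof (rule crd_eqI)
          fix k :: nat assume k: "k < 16"
          show "crd k (v i) = crd k (p i)"
          proof (cases "wt k = i")
            case False
            then show ?thesis using v p[of i] True k by (auto simp: layer_def PiE_iff)
          next
            case True
            then have "crd k (v i) = crd k x" using coord[of v k] v k by simp
            also have "\<dots> = (\<Sum>j | j < 16 \<and> wt j = i. if k = j then crd j x else 0)"
              using k True by (simp add: sum.delta)
            also have "\<dots> = crd k (p i)"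
              unfolding p_def crd_simps using k by (intro sum.cong) (auto simp: crd_bas)
            finally show ?thesis .
          qed
        qed
        with True show ?thesis by simp
      next
        case False
        with v show ?thesis by (auto simp: PiE_iff extensional_def)
      qed
    qed
  qed
qed

lemma crd_in_covectors: "k < 16 \<Longrightarrow> crd k \<in> covectors s (layer wt) (wt k)"
  by (auto simp: covectors_def linear_crd layer_def)

section \<open>Lie algebras given by a table of brackets\<close>

text \<open>An entry \<open>(i, j, k)\<close> of the table contributes \<open>bas k\<close> to \<open>[bas i, bas j]\<close> and hence \<open>- bas k\<close> to
  \<open>[bas j, bas i]\<close>; contributions add up.\<close>

definition table_bracket :: "(nat \<times> nat \<times> nat) list \<Rightarrow> real^16 \<Rightarrow> real^16 \<Rightarrow> real^16" where
  "table_bracket T x y =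
     (\<Sum>(i, j, k)\<leftarrow>T. (crd i x * crd j y - crd j x * crd i y) *\<^sub>R bas k)"

lemma bilinear_table_bracket: "bilinear (table_bracket T)"
proof (induction T)
  case Nil
  show ?case by (simp add: table_bracket_def bilinear_def linear_zero)
next
  case (Cons a T)
  obtain i j k where a: "a = (i, j, k)" by (cases a) 
  have "table_bracket (a # T) = (\<lambda>x y. (crd i x * crd j y - crd j x * crd i y) *\<^sub>R bas k + table_bracket T x y)"
    by (simp add: table_bracket_def a fun_eq_iff)
  with Cons show ?case
    by (auto simp: bilinear_def linear_iff algebra_simps)
qed

lemma table_bracket_self: "table_bracket T x x = 0"
  by (induction T) (auto simp: table_bracket_def mult.commute)

lemma table_bracket_layer:
  assumes T: "\<And>i j k. (i, j, k) \<in> set T \<Longrightarrow> i < 16 \<and> j < 16 \<and> k < 16 \<and> wt i + wt j = wt k"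
    and x: "x \<in> layer wt a" and y: "y \<in> layer wt b"
  shows "table_bracket T x y \<in> layer wt (a + b)"
  using T
proof (induction T)
  case Nil
  show ?case by (simp add: table_bracket_def subspace_0[OF subspace_layer])
next
  case (Cons t T)
  obtain i j k where t: "t = (i, j, k)" by (cases t) 
  have ijk: "i < 16" "j < 16" "k < 16" "wt i + wt j = wt k" using Cons.prems[of i j k] t by auto
  have "(crd i x * crd j y - crd j x * crd i y) *\<^sub>R bas k \<in> layer wt (a + b)"
  proof (cases "wt k = a + b")
    case True
    then show ?thesis using ijk by (intro subspace_scale[OF subspace_layer] bas_in_layer)
  next
    case False
    then have "wt i \<noteq> a \<or> wt j \<noteq> b" "wt j \<noteq> a \<or> wt i \<noteq> b" using ijk(4) by auto
    then have "crd i x * crd j y = 0" "crd j x * crd i y = 0"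
      using x y ijk by (auto simp: layer_def)
    then have "crd i x * crd j y - crd j x * crd i y = 0" by auto
    then show ?thesis by (simp add: subspace_0[OF subspace_layer])
  qed
  moreover have "table_bracket T x y \<in> layer wt (a + b)"
    using Cons by (meson list.set_intros(2))
  ultimately show ?case
    by (simp add: table_bracket_def t subspace_add[OF subspace_layer])
qed

lemma carnot_algebra_table:
  assumes wt: "\<And>k. k < 16 \<Longrightarrow> wt k \<in> {1..3}"
    and T: "\<And>i j k. (i, j, k) \<in> set T \<Longrightarrow> i < 16 \<and> j < 16 \<and> k < 16 \<and> wt i + wt j = wt k"
    and top: "\<exists>k<16. wt k = 3"
    and gen: "\<And>k. k < 16 \<Longrightarrow> wt k \<noteq> 1 \<Longrightarrow>
        \<exists>i<16. \<exists>j<16. wt i = 1 \<and> Suc (wt j) = wt k \<and> table_bracket T (bas i) (bas j) = bas k"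
    and jac: "\<And>x y z. table_bracket T x (table_bracket T y z) + table_bracket T y (table_bracket T z x)
        + table_bracket T z (table_bracket T x y) = 0"
  shows "carnot_algebra (table_bracket T) 3 (layer wt)"
proof
  let ?br = "table_bracket T"
  show "bilinear ?br" by (rule bilinear_table_bracket)
  show "?br x x = 0" for x by (rule table_bracket_self)
  show "?br x (?br y z) + ?br y (?br z x) + ?br z (?br x y) = 0" for x y z by (rule jac)
  show "\<exists>B::(real^16) set. finite B \<and> span B = UNIV"
    using finite_Basis span_Basis by blast
  show "1 \<le> (3::nat)" by simp
  show "subspace (layer wt i)" for i by (rule subspace_layer)
  show "\<exists>!v. v \<in> (\<Pi>\<^sub>E i\<in>{1..3}. layer wt i) \<and> x = (\<Sum>i=1..3. v i)" for x
    by (rule layers_direct_sum[OF wt])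
  show "layer wt 3 \<noteq> {0}"
  proof -
    from top obtain k where k: "k < 16" "wt k = 3" by blast
    then have "bas k \<in> layer wt 3" by (rule bas_in_layer)
    moreover have "bas k \<noteq> 0" using crd_bas[OF k(1) k(1)] by auto
    ultimately show ?thesis by auto
  qed
  show "span {?br x y |x y. x \<in> layer wt 1 \<and> y \<in> layer wt i} = layer wt (Suc i)"
    (is "span ?S = _") if i: "1 \<le> i" for i
  proof
    show "span ?S \<subseteq> layer wt (Suc i)"
    proof (intro span_minimal subspace_layer subsetI)
      fix v assume "v \<in> ?S"
      then obtain x y where v: "v = ?br x y" "x \<in> layer wt 1" "y \<in> layer wt i" by blast
      from table_bracket_layer[OF T v(2,3)] show "v \<in> layer wt (Suc i)" by (simp add: v(1))
    qed
    show "layer wt (Suc i) \<subseteq> span ?S"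
      unfolding layer_eq_span[of wt "Suc i"]
    proof (intro span_minimal subspace_span subsetI)
      fix v assume "v \<in> bas ` {k. k < 16 \<and> wt k = Suc i}"
      then obtain k where k: "k < 16" "wt k = Suc i" "v = bas k" by blast
      with gen[of k] i obtain a b where ab: "a < 16" "b < 16" "wt a = 1" "Suc (wt b) = wt k" "?br (bas a) (bas b) = bas k"
        by auto
      then have "bas a \<in> layer wt 1" "bas b \<in> layer wt i" using k by (simp_all add: bas_in_layer)
      with ab(5)[symmetric] k(3) have "v \<in> ?S" by blast
      then show "v \<in> span ?S" by (rule span_base)
    qed
  qed
  show "?br x y = 0" if "x \<in> layer wt 1" "y \<in> layer wt 3" for x y
  proof -
    have "?br x y \<in> layer wt (1 + 3)" using that by (intro table_bracket_layer[OF T])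
    then have "crd k (?br x y) = 0" if "k < 16" for k
      using wt[OF that] that unfolding layer_def by force
    then show ?thesis by (intro crd_eqI) simp
  qed
qed

text \<open>The cocycle identity for \<open>x\<close>, \<open>y\<close> and a central \<open>z\<close> has only one nonzero term.\<close>

lemma cocycle_2_central:
  assumes \<omega>: "\<omega> \<in> cocycles br s V 2 w" and z: "\<And>x. br x z = 0"
  shows "\<omega> [br x y, z] = 0"
proof -
  have "\<omega> \<in> forms s V 2 w" using \<omega> by (simp add: cocycles_2_iff)
  then have "bilinear (\<lambda>x y. \<omega> [x, y])" by (rule forms_2_bilinear)
  from bilinear_lzero[OF this] have "\<omega> [0, v] = 0" for v .
  moreover have "\<omega> [br x y, z] - \<omega> [br x z, y] + \<omega> [br y z, x] = 0"
    using \<omega> by (simp add: cocycles_2_iff)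
  ultimately show ?thesis by (simp add: z)
qed

section \<open>The algebra without relations of weight two\<close>

text \<open>The literal \<open>1\<close> is kept as such, so that rewrite rules for concrete indices apply to it.\<close>

declare One_nat_def [simp del]

text \<open>The first ten entries define the free two-step nilpotent algebra on \<open>bas 0\<close>, \<dots>, \<open>bas 4\<close>.\<close>

definition near_free_table :: "(nat \<times> nat \<times> nat) list" where
  "near_free_table =
     [(0, 1, 5), (0, 2, 6), (0, 3, 7), (0, 4, 8), (1, 2, 9), (1, 3, 10), (1, 4, 11), (2, 3, 12),
      (2, 4, 13), (3, 4, 14), (0, 5, 15)]"

definition near_free_wt :: "nat \<Rightarrow> nat" where
  "near_free_wt k = (if k < 5 then 1 else if k < 15 then 2 else 3)"

abbreviation near_free_bracket :: "real^16 \<Rightarrow> real^16 \<Rightarrow> real^16" where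
  "near_free_bracket \<equiv> table_bracket near_free_table"

lemma crd_near_free_bracket:
  "k < 5 \<Longrightarrow> crd k (near_free_bracket x y) = 0"
  "crd 5 (near_free_bracket x y) = crd 0 x * crd 1 y - crd 1 x * crd 0 y"
  "crd 6 (near_free_bracket x y) = crd 0 x * crd 2 y - crd 2 x * crd 0 y"
  "crd 7 (near_free_bracket x y) = crd 0 x * crd 3 y - crd 3 x * crd 0 y"
  "crd 8 (near_free_bracket x y) = crd 0 x * crd 4 y - crd 4 x * crd 0 y"
  "crd 9 (near_free_bracket x y) = crd 1 x * crd 2 y - crd 2 x * crd 1 y"
  "crd 10 (near_free_bracket x y) = crd 1 x * crd 3 y - crd 3 x * crd 1 y"
  "crd 11 (near_free_bracket x y) = crd 1 x * crd 4 y - crd 4 x * crd 1 y"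
  "crd 12 (near_free_bracket x y) = crd 2 x * crd 3 y - crd 3 x * crd 2 y"
  "crd 13 (near_free_bracket x y) = crd 2 x * crd 4 y - crd 4 x * crd 2 y"
  "crd 14 (near_free_bracket x y) = crd 3 x * crd 4 y - crd 4 x * crd 3 y"
  "crd 15 (near_free_bracket x y) = crd 0 x * crd 5 y - crd 5 x * crd 0 y"
  by (simp_all add: table_bracket_def near_free_table_def crd_bas)

lemma near_free_table_graded:
  "(i, j, k) \<in> set near_free_table \<Longrightarrow> i < 16 \<and> j < 16 \<and> k < 16 \<and> near_free_wt i + near_free_wt j = near_free_wt k"
  by (auto simp: near_free_table_def near_free_wt_def)

lemma near_free_jacobi:
  "near_free_bracket x (near_free_bracket y z) + near_free_bracket y (near_free_bracket z x) + near_free_bracket z (near_free_bracket x y) = 0"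
  (is "?J = 0")
proof (rule crd_eqI)
  have "\<forall>k<16. crd k ?J = crd k 0"
    unfolding all_less_16 by (simp add: crd_near_free_bracket) (simp add: algebra_simps)
  then show "k < 16 \<Longrightarrow> crd k ?J = crd k 0" for k by blast
qed

lemma near_free_bracket_bas:
  assumes "k < 16" "5 \<le> k"
  shows "\<exists>i<16. \<exists>j<16. near_free_wt i = 1 \<and> Suc (near_free_wt j) = near_free_wt k \<and> near_free_bracket (bas i) (bas j) = bas k"
proof -
  let ?i = "\<lambda>k. [0::nat, 0, 0, 0, 1, 1, 1, 2, 2, 3, 0] ! (k - 5)"
    and ?j = "\<lambda>k. [1::nat, 2, 3, 4, 2, 3, 4, 3, 4, 4, 5] ! (k - 5)"
  have "\<forall>k<16. 5 \<le> k \<longrightarrow> ?i k < 16 \<and> ?j k < 16 \<and> near_free_wt (?i k) = 1 \<and> Suc (near_free_wt (?j k)) = near_free_wt k \<and>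
      near_free_bracket (bas (?i k)) (bas (?j k)) = bas k"
    unfolding all_less_16
    by (simp add: table_bracket_def near_free_table_def crd_bas near_free_wt_def)
  with assms show ?thesis by blast
qed

lemma carnot_near_free: "carnot_algebra near_free_bracket 3 (layer near_free_wt)"
proof (rule carnot_algebra_table[OF _ near_free_table_graded _ _ near_free_jacobi])
  show "near_free_wt k \<in> {1..3}" for k by (simp add: near_free_wt_def)
  show "\<exists>k<16. near_free_wt k = 3" by (rule exI[of _ 15]) (simp add: near_free_wt_def)
  show "\<exists>i<16. \<exists>j<16. near_free_wt i = 1 \<and> Suc (near_free_wt j) = near_free_wt k \<and> near_free_bracket (bas i) (bas j) = bas k"
    if "k < 16" "near_free_wt k \<noteq> 1" for k
    using that by (intro near_free_bracket_bas) (auto simp: near_free_wt_def split: if_splits)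
qed

lemma homogeneous_dim_near_free: "homogeneous_dim 3 (layer near_free_wt) = 28"
proof -
  have "{k. k < 16 \<and> near_free_wt k = 1} = {..<5}" "{k. k < 16 \<and> near_free_wt k = 2} = {5..<15}"
    "{k. k < 16 \<and> near_free_wt k = 3} = {15..<16}"
    by (auto simp: near_free_wt_def)
  moreover have "{1..3} = {1, 2, 3::nat}" by auto
  ultimately show ?thesis by (simp add: homogeneous_dim_def dim_layer)
qed

text \<open>The cocycle below comes from the relation \<open>[e\<^sub>1, [e\<^sub>0, e\<^sub>1]] = 0\<close>: it is nonzero on
  \<open>bas 1\<close> and \<open>bas 5\<close>, whose bracket is zero.\<close>

lemma near_free_cohomology_weight_3: "cohomology_nonzero near_free_bracket 3 (layer near_free_wt) 2 3"
  unfolding cohomology_nonzero_2_iff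
proof (intro bexI ballI)
  let ?\<omega> = "wedge [crd 1, crd 5]"
  have "?\<omega> \<in> forms 3 (layer near_free_wt) 2 (near_free_wt 1 + near_free_wt 5)"
    by (intro wedge_pair_in_forms crd_in_covectors) simp_all
  then show "?\<omega> \<in> cocycles near_free_bracket 3 (layer near_free_wt) 2 3"
    by (simp add: near_free_wt_def cocycles_2_iff wedge_pair crd_near_free_bracket algebra_simps)
  fix \<alpha> assume "\<alpha> \<in> covectors 3 (layer near_free_wt) 3"
  then have "\<alpha> 0 = 0" by (auto simp: covectors_def linear_0)
  then have "?\<omega> [bas 1, bas 5] \<noteq> - \<alpha> (near_free_bracket (bas 1) (bas 5))"
    by (simp add: wedge_pair table_bracket_def near_free_table_def crd_bas)
  then show "\<exists>x y. ?\<omega> [x, y] \<noteq> - \<alpha> (near_free_bracket x y)" by blast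
qed

text \<open>A form of weight at most two lives on pairs of generators, and there each pair has its own bracket
  \<open>bas k\<close>, so every such form is exact.\<close>

lemma near_free_cohomology_weight_le_2:
  assumes w: "w \<le> 2"
  shows "\<not> cohomology_nonzero near_free_bracket 3 (layer near_free_wt) 2 w"
proof -
  have "\<exists>\<alpha>\<in>covectors 3 (layer near_free_wt) w. \<forall>x y. \<omega> [x, y] = - \<alpha> (near_free_bracket x y)"
    if \<omega>: "\<omega> \<in> cocycles near_free_bracket 3 (layer near_free_wt) 2 w" for \<omega>
  proof -
    define B where "B x y = \<omega> [x, y]" for x y
    have form: "\<omega> \<in> forms 3 (layer near_free_wt) 2 w"
      using \<omega> by (simp add: cocycles_2_iff)
    have bil: "bilinear B"
      using forms_2_bilinear[OF form] by (simp add: B_def[abs_def])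
    have alt: "B x x = 0" for x
      using forms_2_alternating[OF form] by (simp add: B_def)
    have wt0: "B (bas i) (bas j) = 0" if "i < 16" "j < 16" "near_free_wt i + near_free_wt j \<noteq> w" for i j
      unfolding B_def using that
      by (intro forms_2_weight[OF form, of "near_free_wt i" "near_free_wt j"] bas_in_layer) (simp_all add: near_free_wt_def)
    define \<alpha> where "\<alpha> x =
        B (bas 1) (bas 0) * crd 5 x + B (bas 2) (bas 0) * crd 6 x + B (bas 3) (bas 0) * crd 7 x
      + B (bas 4) (bas 0) * crd 8 x + B (bas 2) (bas 1) * crd 9 x + B (bas 3) (bas 1) * crd 10 x
      + B (bas 4) (bas 1) * crd 11 x + B (bas 3) (bas 2) * crd 12 x + B (bas 4) (bas 2) * crd 13 x
      + B (bas 4) (bas 3) * crd 14 x" for x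
    have lin: "linear \<alpha>" by (simp add: linear_iff \<alpha>_def algebra_simps)
    have cov: "\<alpha> \<in> covectors 3 (layer near_free_wt) w"
    proof -
      have "\<alpha> x = 0" if i: "i \<in> {1..3}" "i \<noteq> w" and x: "x \<in> layer near_free_wt i" for i x
      proof (cases "i = 2")
        case True
        with i have "B (bas k) (bas l) = 0" if "k < 5" "l < 5" for k l
          using that by (intro wt0) (simp_all add: near_free_wt_def)
        then show ?thesis by (simp add: \<alpha>_def)
      next
        case False
        then have "crd k x = 0" if "5 \<le> k" "k < 15" for k
          using x that by (simp add: layer_def near_free_wt_def)
        then show ?thesis by (simp add: \<alpha>_def)
      qed
      with lin show ?thesis by (simp add: covectors_def)
    qed
    have "B x y = - \<alpha> (near_free_bracket x y)" for x y
    proof (rule alternating_eqI[OF bil alt])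
      show "bilinear (\<lambda>x y. - \<alpha> (near_free_bracket x y))"
        by (simp add: bilinear_def linear_iff \<alpha>_def crd_near_free_bracket algebra_simps)
      show "- \<alpha> (near_free_bracket x x) = 0" for x
        by (simp add: table_bracket_self linear_0[OF lin])
      fix i j :: nat assume ij: "i < 16" "j < i"
      show "B (bas i) (bas j) = - \<alpha> (near_free_bracket (bas i) (bas j))"
      proof (cases "5 \<le> i")
        case True
        with ij have "B (bas i) (bas j) = 0" using w by (intro wt0) (simp_all add: near_free_wt_def)
        moreover from True ij have "\<alpha> (near_free_bracket (bas i) (bas j)) = 0"
          by (simp add: \<alpha>_def crd_near_free_bracket crd_bas)
        ultimately show ?thesis by simp
      next
        case False
        have "\<forall>i<16. \<forall>j<16. i < 5 \<and> j < i \<longrightarrow> B (bas i) (bas j) = - \<alpha> (near_free_bracket (bas i) (bas j))"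
          unfolding all_less_16 by (simp add: \<alpha>_def crd_near_free_bracket crd_bas)
        with False ij show ?thesis by simp
      qed
    qed
    with cov show ?thesis by (auto simp: B_def)
  qed
  then show ?thesis unfolding cohomology_nonzero_2_iff by blast
qed

lemma is_w_min_near_free: "is_w_min near_free_bracket 3 (layer near_free_wt) 3"
  unfolding is_w_min_def
  using near_free_cohomology_weight_3 near_free_cohomology_weight_le_2 by (metis linorder_not_le numeral_2_eq_2 numeral_3_eq_3 less_Suc_eq_le)

section \<open>The quadratically presented algebra\<close>

text \<open>The vectors \<open>bas 0\<close>, \<dots>, \<open>bas 7\<close> generate, and \<open>bas 6\<close>, \<open>bas 7\<close> are central.\<close>

definition quad_table :: "(nat \<times> nat \<times> nat) list" where
  "quad_table =
     [(3, 1, 8), (0, 5, 8), (0, 1, 9), (4, 5, 9), (0, 4, 10), (2, 1, 10), (0, 1, 11), (2, 3, 11),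
      (1, 8, 12), (5, 9, 12), (4, 9, 13), (1, 10, 13), (0, 10, 14), (2, 11, 14), (3, 11, 15), (0, 8, 15)]"

definition quad_wt :: "nat \<Rightarrow> nat" where
  "quad_wt k = (if k < 8 then 1 else if k < 12 then 2 else 3)"

abbreviation quad_bracket :: "real^16 \<Rightarrow> real^16 \<Rightarrow> real^16" where
  "quad_bracket \<equiv> table_bracket quad_table"

lemma crd_quad_bracket:
  "k < 8 \<Longrightarrow> crd k (quad_bracket x y) = 0"
  "crd 8 (quad_bracket x y) = crd 3 x * crd 1 y - crd 1 x * crd 3 y + crd 0 x * crd 5 y - crd 5 x * crd 0 y"
  "crd 9 (quad_bracket x y) = crd 0 x * crd 1 y - crd 1 x * crd 0 y + crd 4 x * crd 5 y - crd 5 x * crd 4 y"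
  "crd 10 (quad_bracket x y) = crd 0 x * crd 4 y - crd 4 x * crd 0 y + crd 2 x * crd 1 y - crd 1 x * crd 2 y"
  "crd 11 (quad_bracket x y) = crd 0 x * crd 1 y - crd 1 x * crd 0 y + crd 2 x * crd 3 y - crd 3 x * crd 2 y"
  "crd 12 (quad_bracket x y) = crd 1 x * crd 8 y - crd 8 x * crd 1 y + crd 5 x * crd 9 y - crd 9 x * crd 5 y"
  "crd 13 (quad_bracket x y) = crd 4 x * crd 9 y - crd 9 x * crd 4 y + crd 1 x * crd 10 y - crd 10 x * crd 1 y"
  "crd 14 (quad_bracket x y) = crd 0 x * crd 10 y - crd 10 x * crd 0 y + crd 2 x * crd 11 y - crd 11 x * crd 2 y"
  "crd 15 (quad_bracket x y) = crd 3 x * crd 11 y - crd 11 x * crd 3 y + crd 0 x * crd 8 y - crd 8 x * crd 0 y"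
  by (simp_all add: table_bracket_def quad_table_def crd_bas)

lemma quad_table_graded:
  "(i, j, k) \<in> set quad_table \<Longrightarrow> i < 16 \<and> j < 16 \<and> k < 16 \<and> quad_wt i + quad_wt j = quad_wt k"
  by (auto simp: quad_table_def quad_wt_def)

lemma quad_jacobi:
  "quad_bracket x (quad_bracket y z) + quad_bracket y (quad_bracket z x) + quad_bracket z (quad_bracket x y) = 0"
  (is "?J = 0")
proof (rule crd_eqI)
  have "\<forall>k<16. crd k ?J = crd k 0"
    unfolding all_less_16 by (simp add: crd_quad_bracket) (simp add: algebra_simps)
  then show "k < 16 \<Longrightarrow> crd k ?J = crd k 0" for k by blast
qed

lemma quad_bracket_bas:
  assumes "k < 16" "8 \<le> k"
  shows "\<exists>i<16. \<exists>j<16. quad_wt i = 1 \<and> Suc (quad_wt j) = quad_wt k \<and> quad_bracket (bas i) (bas j) = bas k"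
proof -
  let ?i = "\<lambda>k. [3::nat, 4, 0, 2, 1, 4, 0, 3] ! (k - 8)" and ?j = "\<lambda>k. [1::nat, 5, 4, 3, 8, 9, 10, 11] ! (k - 8)"
  have "\<forall>k<16. 8 \<le> k \<longrightarrow> ?i k < 16 \<and> ?j k < 16 \<and> quad_wt (?i k) = 1 \<and> Suc (quad_wt (?j k)) = quad_wt k \<and>
      quad_bracket (bas (?i k)) (bas (?j k)) = bas k"
    unfolding all_less_16
    by (simp add: table_bracket_def quad_table_def crd_bas quad_wt_def)
  with assms show ?thesis by blast
qed

lemma carnot_quad: "carnot_algebra quad_bracket 3 (layer quad_wt)"
proof (rule carnot_algebra_table[OF _ quad_table_graded _ _ quad_jacobi])
  show "quad_wt k \<in> {1..3}" for k by (simp add: quad_wt_def)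
  show "\<exists>k<16. quad_wt k = 3" by (rule exI[of _ 12]) (simp add: quad_wt_def)
  show "\<exists>i<16. \<exists>j<16. quad_wt i = 1 \<and> Suc (quad_wt j) = quad_wt k \<and> quad_bracket (bas i) (bas j) = bas k"
    if "k < 16" "quad_wt k \<noteq> 1" for k
    using that by (intro quad_bracket_bas) (auto simp: quad_wt_def split: if_splits)
qed

lemma homogeneous_dim_quad: "homogeneous_dim 3 (layer quad_wt) = 28"
proof -
  have "{k. k < 16 \<and> quad_wt k = 1} = {..<8}" "{k. k < 16 \<and> quad_wt k = 2} = {8..<12}"
    "{k. k < 16 \<and> quad_wt k = 3} = {12..<16}"
    by (auto simp: quad_wt_def)
  moreover have "{1..3} = {1, 2, 3::nat}" by auto
  ultimately show ?thesis by (simp add: homogeneous_dim_def dim_layer)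
qed

lemma quad_cohomology_weight_2: "cohomology_nonzero quad_bracket 3 (layer quad_wt) 2 2"
  unfolding cohomology_nonzero_2_iff
proof (intro bexI ballI)
  let ?\<omega> = "wedge [crd 6, crd 7]"
  have "?\<omega> \<in> forms 3 (layer quad_wt) 2 (quad_wt 6 + quad_wt 7)"
    by (intro wedge_pair_in_forms crd_in_covectors) simp_all
  then show "?\<omega> \<in> cocycles quad_bracket 3 (layer quad_wt) 2 2"
    by (simp add: quad_wt_def cocycles_2_iff wedge_pair crd_quad_bracket)
  fix \<alpha> assume "\<alpha> \<in> covectors 3 (layer quad_wt) 2"
  then have "\<alpha> 0 = 0" by (auto simp: covectors_def linear_0)
  then have "?\<omega> [bas 6, bas 7] \<noteq> - \<alpha> (quad_bracket (bas 6) (bas 7))"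
    by (simp add: wedge_pair table_bracket_def quad_table_def crd_bas)
  then show "\<exists>x y. ?\<omega> [x, y] \<noteq> - \<alpha> (quad_bracket x y)" by blast
qed

text \<open>The proof treats all weights \<open>w \<ge> 3\<close> at once: a cocycle \<open>B\<close> vanishes on pairs of generators, and
  the cocycle identities on triples of basis vectors determine it up to four parameters, which are
  the coefficients of a covector of weight three.\<close>

lemma quad_cohomology_weight_ge_3:
  assumes w: "3 \<le> w"
  shows "\<not> cohomology_nonzero quad_bracket 3 (layer quad_wt) 2 w"
proof -
  have "\<exists>\<alpha>\<in>covectors 3 (layer quad_wt) w. \<forall>x y. \<omega> [x, y] = - \<alpha> (quad_bracket x y)"
    if \<omega>: "\<omega> \<in> cocycles quad_bracket 3 (layer quad_wt) 2 w" for \<omega>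
  proof -
    define B where "B x y = \<omega> [x, y]" for x y
    have form: "\<omega> \<in> forms 3 (layer quad_wt) 2 w"
      and closed: "B (quad_bracket x y) z - B (quad_bracket x z) y + B (quad_bracket y z) x = 0" for x y z
      using \<omega> by (simp_all add: cocycles_2_iff B_def)
    have bil: "bilinear B"
      using forms_2_bilinear[OF form] by (simp add: B_def[abs_def])
    have alt: "B x x = 0" for x
      using forms_2_alternating[OF form] by (simp add: B_def)
    have wt0: "B (bas i) (bas j) = 0" if "i < 16" "j < 16" "quad_wt i + quad_wt j \<noteq> w" for i j
      unfolding B_def using that
      by (intro forms_2_weight[OF form, of "quad_wt i" "quad_wt j"] bas_in_layer) (simp_all add: quad_wt_def)
    note expand = bilinear_ladd[OF bil] bilinear_lneg[OF bil] bilinear_lzero[OF bil]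
      table_bracket_def quad_table_def crd_bas
    have skew: "B (bas i) (bas j) = - B (bas j) (bas i)" if "i < j" for i j
      by (rule alternating_skew[OF bil alt])
    note c = closed[of "bas i" "bas j" "bas k" for i j k]
    have central: "B (bas k) (bas l) = 0 \<and> B (bas l) (bas k) = 0"
      if k: "k < 16" "8 \<le> k" and l: "l \<in> {6, 7, 12, 13, 14, 15}" for k l
    proof -
      have "quad_bracket x (bas l) = 0" for x
      proof (rule crd_eqI)
        have "\<forall>k<16. crd k (quad_bracket x (bas l)) = 0"
          using l unfolding all_less_16 by (auto simp: crd_quad_bracket crd_bas)
        then show "k < 16 \<Longrightarrow> crd k (quad_bracket x (bas l)) = crd k 0" for k by simp
      qed
      then have "\<omega> [quad_bracket x y, bas l] = 0" for x y
        by (rule cocycle_2_central[OF \<omega>])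
      with quad_bracket_bas[OF k] have "B (bas k) (bas l) = 0" unfolding B_def by metis
      with alternating_skew[OF bil alt, of "bas k" "bas l"] show ?thesis by simp
    qed
    \<comment> \<open>The twenty identities on triples of the noncentral generators reduce the weight three part of \<open>B\<close> to four
      free parameters.\<close>
    have zero3: "B (bas 11) (bas 0) = 0 \<and> B (bas 10) (bas 2) = 0 \<and> B (bas 8) (bas 2) = 0 \<and>
        B (bas 10) (bas 3) = 0 \<and> B (bas 8) (bas 3) = 0 \<and> B (bas 11) (bas 1) = 0 \<and> B (bas 10) (bas 4) = 0 \<and>
        B (bas 10) (bas 5) = 0 \<and> B (bas 8) (bas 4) = 0 \<and> B (bas 8) (bas 5) = 0 \<and> B (bas 9) (bas 1) = 0 \<and>
        B (bas 11) (bas 4) = 0 \<and> B (bas 11) (bas 5) = 0 \<and> B (bas 9) (bas 2) = 0 \<and> B (bas 9) (bas 3) = 0 \<and>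
        B (bas 9) (bas 0) = 0"
      using c[of 0 2 3] c[of 0 2 4] c[of 0 2 5] c[of 0 3 4] c[of 0 3 5] c[of 1 2 3] c[of 1 2 4] c[of 1 2 5]
        c[of 1 3 4] c[of 1 3 5] c[of 1 4 5] c[of 2 3 4] c[of 2 3 5] c[of 2 4 5] c[of 3 4 5] c[of 0 4 5]
      by (simp add: expand)
    have rel3: "B (bas 11) (bas 2) = B (bas 10) (bas 0) \<and> B (bas 11) (bas 3) = B (bas 8) (bas 0) \<and>
        B (bas 9) (bas 4) = B (bas 10) (bas 1) \<and> B (bas 9) (bas 5) = B (bas 8) (bas 1)"
      using c[of 0 1 2] c[of 0 1 3] c[of 0 1 4] c[of 0 1 5] by (simp add: expand zero3)
    \<comment> \<open>The weight four part is forced to vanish.\<close>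
    have zero4: "B (bas 11) (bas 9) = 0 \<and> B (bas 15) (bas 2) = 0 \<and> B (bas 14) (bas 2) = 0 \<and>
        B (bas 14) (bas 0) = 0 \<and> B (bas 15) (bas 3) = 0 \<and> B (bas 14) (bas 3) = 0 \<and> B (bas 15) (bas 0) = 0 \<and>
        B (bas 14) (bas 4) = 0 \<and> B (bas 11) (bas 10) = 0 \<and> B (bas 15) (bas 5) = 0 \<and> B (bas 11) (bas 8) = 0 \<and>
        B (bas 10) (bas 9) = 0 \<and> B (bas 13) (bas 2) = 0 \<and> B (bas 14) (bas 1) = 0 \<and> B (bas 12) (bas 3) = 0 \<and>
        B (bas 9) (bas 8) = 0 \<and> B (bas 15) (bas 1) = 0 \<and> B (bas 12) (bas 4) = 0 \<and> B (bas 13) (bas 1) = 0 \<and>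
        B (bas 13) (bas 4) = 0 \<and> B (bas 12) (bas 5) = 0 \<and> B (bas 12) (bas 1) = 0 \<and> B (bas 13) (bas 5) = 0 \<and>
        B (bas 12) (bas 2) = 0 \<and> B (bas 14) (bas 5) = 0 \<and> B (bas 13) (bas 3) = 0 \<and> B (bas 15) (bas 4) = 0 \<and>
        B (bas 12) (bas 0) = 0 \<and> B (bas 13) (bas 0) = 0 \<and> B (bas 10) (bas 8) = 0"
      using c[of 0 1 9] c[of 0 2 8] c[of 0 2 10] c[of 0 2 11] c[of 0 3 8] c[of 0 3 10] c[of 0 3 11]
        c[of 0 4 10] c[of 0 4 11] c[of 0 5 8] c[of 0 5 11] c[of 1 2 9] c[of 1 2 10] c[of 1 2 11] c[of 1 3 8]
        c[of 1 3 9] c[of 1 3 11] c[of 1 4 8] c[of 1 4 9] c[of 1 4 10] c[of 1 5 8] c[of 1 5 9] c[of 1 5 10]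
        c[of 2 5 9] c[of 2 5 11] c[of 3 4 9] c[of 3 4 11] c[of 0 1 8] c[of 0 1 10] c[of 0 4 8]
      by (simp add: expand alt skew)
    define \<alpha> where "\<alpha> x = B (bas 8) (bas 1) * crd 12 x + B (bas 10) (bas 1) * crd 13 x
        + B (bas 10) (bas 0) * crd 14 x + B (bas 8) (bas 0) * crd 15 x" for x
    have lin: "linear \<alpha>" by (simp add: linear_iff \<alpha>_def algebra_simps)
    have cov: "\<alpha> \<in> covectors 3 (layer quad_wt) w"
    proof -
      have "\<alpha> x = 0" if i: "i \<in> {1..3}" "i \<noteq> w" and x: "x \<in> layer quad_wt i" for i x
      proof (cases "i = 3")
        \<comment> \<open>Then \<open>w > 3\<close>, and the parameters vanish for reasons of weight.\<close>
        case True
        with i have "B (bas 8) (bas 1) = 0" "B (bas 10) (bas 1) = 0" "B (bas 10) (bas 0) = 0" "B (bas 8) (bas 0) = 0"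
          by (auto intro!: wt0 simp: quad_wt_def)
        then show ?thesis by (simp add: \<alpha>_def)
      next
        case False
        then have "crd 12 x = 0" "crd 13 x = 0" "crd 14 x = 0" "crd 15 x = 0"
          using x by (auto simp: layer_def quad_wt_def)
        then show ?thesis by (simp add: \<alpha>_def)
      qed
      with lin show ?thesis by (simp add: covectors_def)
    qed
    have "B x y = - \<alpha> (quad_bracket x y)" for x y
    proof (rule alternating_eqI[OF bil alt])
      show "bilinear (\<lambda>x y. - \<alpha> (quad_bracket x y))"
        by (simp add: bilinear_def linear_iff \<alpha>_def crd_quad_bracket algebra_simps)
      show "- \<alpha> (quad_bracket x x) = 0" for x
        by (simp add: table_bracket_self linear_0[OF lin])
      fix i j :: nat assume ij: "i < 16" "j < i"
      show "B (bas i) (bas j) = - \<alpha> (quad_bracket (bas i) (bas j))"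
      proof (cases "8 \<le> i")
        case False
        with ij have "B (bas i) (bas j) = 0" using w by (intro wt0) (simp_all add: quad_wt_def)
        moreover from False ij have "\<alpha> (quad_bracket (bas i) (bas j)) = 0"
          by (simp add: \<alpha>_def crd_quad_bracket crd_bas)
        ultimately show ?thesis by simp
      next
        case True
        have "\<forall>i<16. \<forall>j<16. 8 \<le> i \<and> j < i \<longrightarrow> B (bas i) (bas j) = - \<alpha> (quad_bracket (bas i) (bas j))"
          unfolding all_less_16
          by (simp add: zero3 zero4 rel3 central \<alpha>_def crd_quad_bracket crd_bas)
        with True ij show ?thesis by simp
      qed
    qed
    with cov show ?thesis by (auto simp: B_def)
  qed
  then show ?thesis unfolding cohomology_nonzero_2_iff by blast
qed

lemma is_w_max_quad: "is_w_max quad_bracket 3 (layer quad_wt) 2"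
  unfolding is_w_max_def
  using quad_cohomology_weight_2 quad_cohomology_weight_ge_3 by (metis linorder_not_le numeral_2_eq_2 numeral_3_eq_3 Suc_leI)

section \<open>The two examples\<close>

theorem mainTheorem5:
  "\<exists>(brf :: real^16 \<Rightarrow> real^16 \<Rightarrow> real^16) (F :: nat \<Rightarrow> (real^16) set)
     (brg :: real^16 \<Rightarrow> real^16 \<Rightarrow> real^16) (G :: nat \<Rightarrow> (real^16) set).
     carnot_algebra brf 3 F \<and> carnot_algebra brg 3 G \<and>
     dim (UNIV :: (real^16) set) = 16 \<and>
     homogeneous_dim 3 F = 28 \<and> homogeneous_dim 3 G = 28 \<and>
     is_w_min brf 3 F 3 \<and> is_w_max brg 3 G 2"
proof (intro exI conjI)
  show "carnot_algebra near_free_bracket 3 (layer near_free_wt)" by (rule carnot_near_free)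
  show "carnot_algebra quad_bracket 3 (layer quad_wt)" by (rule carnot_quad)
  show "dim (UNIV :: (real^16) set) = 16" by simp
  show "homogeneous_dim 3 (layer near_free_wt) = 28" by (rule homogeneous_dim_near_free)
  show "homogeneous_dim 3 (layer quad_wt) = 28" by (rule homogeneous_dim_quad)
  show "is_w_min near_free_bracket 3 (layer near_free_wt) 3" by (rule is_w_min_near_free)
  show "is_w_max quad_bracket 3 (layer quad_wt) 2" by (rule is_w_max_quad)
qed

end
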